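(* Let $\{\mathcal{A}_n(x)\}_{n\ge 0}$ be the scaled Atkin polynomials and let $V_n^{(\alpha,\beta)}(x;c)$, $\mathcal{V}_n^{(\alpha,\beta)}(x;c)$ be the two families of monic associated Jacobi polynomials (all defined in the context). Let $$S=\left\{\left(-\tfrac12,-\tfrac23,\tfrac{13}{12}\right),\left(\tfrac12,-\tfrac23,\tfrac{7}{12}\right),\left(-\tfrac12,\tfrac23,\tfrac{5}{12}\right),\left(\tfrac12,\tfrac23,-\tfrac{1}{12}\right)\right\}.$$ Then for every integer $n\ge 0$ the following identities of polynomials in $x$ hold: for every $(\alpha,\beta,c)\in S$, $$\mathcal{A}_{n+1}(x)=\left(x-\tfrac{5}{12}\right)V_n^{(\alpha,\beta)}(x;c)-\tfrac{455}{3456}\,V_{n-1}^{(\alpha,\beta)}(x;c+1),$$ and moreover $$\mathcal{A}_{n+1}(x)=(x-8)\,V_n^{(-1/2,\,2/3)}\left(x;\tfrac{5}{12}\right)+\tfrac{91}{12}\,\mathcal{V}_n^{(-1/2,\,2/3)}\left(x;\tfrac{5}{12}\right),$$ $$\mathcal{A}_{n+1}(x)=x\,V_n^{(1/2,\,-2/3)}\left(x;\tfrac{7}{12}\right)-\tfrac{5}{12}\,\mathcal{V}_n^{(1/2,\,-2/3)}\left(x;\tfrac{7}{12}\right).$$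
   Context: Scaled Atkin polynomials: $\mathcal{A}_0(x)=1$, $\mathcal{A}_1(x)=x-\frac{5}{12}$, $\mathcal{A}_2(x)=x^2-\frac{205}{216}x+\frac{935}{10368}$, and for $n>1$ $$\mathcal{A}_{n+1}(x)=\left[x-\frac{2(n^2-29/144)}{4n^2-1}\right]\mathcal{A}_n(x)-\frac{(n-\frac{13}{12})(n-\frac{7}{12})(n-\frac{5}{12})(n+\frac1{12})}{2n(2n-1)^2(2n-2)}\mathcal{A}_{n-1}(x).$$ (They are related to the Atkin polynomials $A_n$ by $A_n(1728y)=1728^n\mathcal{A}_n(y)$.) Monic associated Jacobi polynomials: given parameters $(\alpha,\beta,c)$, put $$\lambda_n=\frac{(n+c+\beta+1)(n+c+\alpha+\beta+1)}{(2n+2c+\alpha+\beta+1)(2n+2c+\alpha+\beta+2)},\qquad \mu_n=\frac{(n+c)(n+c+\alpha)}{(2n+2c+\alpha+\beta)(2n+2c+\alpha+\beta+1)}\qquad(n\ge 0).$$ Both $T_n=V_n^{(\alpha,\beta)}(x;c)$ and $T_n=\mathcal{V}_n^{(\alpha,\beta)}(x;c)$ are polynomials in $x$ satisfying, for $n\ge1$, $$T_{n+1}(x)=(x-\lambda_n-\mu_n)T_n(x)-\lambda_{n-1}\mu_n T_{n-1}(x),$$ with initial conditions $V_0=\mathcal{V}_0=1$, $V_1^{(\alpha,\beta)}(x;c)=x-\lambda_0-\mu_0$, $\mathcal{V}_1^{(\alpha,\beta)}(x;c)=x-\lambda_0$. The polynomial $V_n^{(\alpha,\beta)}(x;c+1)$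 is obtained by replacing $c$ by $c+1$ throughout, and $V_{-1}^{(\alpha,\beta)}(x;c+1):=0$. *)

theory Defs
  imports Complex_Main "HOL-Computational_Algebra.Polynomial"
begin

definition atkin_lin :: "nat \<Rightarrow> real" where
  "atkin_lin n = 2 * ((real n)^2 - 29/144) / (4 * (real n)^2 - 1)"

definition atkin_const :: "nat \<Rightarrow> real" where
  "atkin_const n =
     (real n - 13/12) * (real n - 7/12) * (real n - 5/12) * (real n + 1/12) /
     (2 * real n * (2 * real n - 1)^2 * (2 * real n - 2))"

text \<open>The three-term recurrence for the index $n + 1$ is valid only for $n > 1$ (the constant
  coefficient has a zero denominator at $n = 1$), so the first three polynomials are
  given explicitly and the recursive equation uses $n = k + 2$.\<close>

fun scaled_atkin :: "nat \<Rightarrow> real poly" where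
  "scaled_atkin 0 = 1"
| "scaled_atkin (Suc 0) = [:- 5/12, 1:]"
| "scaled_atkin (Suc (Suc 0)) = [:935/10368, - 205/216, 1:]"
| "scaled_atkin (Suc (Suc (Suc k))) =
     [:- atkin_lin (Suc (Suc k)), 1:] * scaled_atkin (Suc (Suc k))
     - smult (atkin_const (Suc (Suc k))) (scaled_atkin (Suc k))"

definition jac_lambda :: "real \<Rightarrow> real \<Rightarrow> real \<Rightarrow> nat \<Rightarrow> real" where
  "jac_lambda \<alpha> \<beta> c n =
     (real n + c + \<beta> + 1) * (real n + c + \<alpha> + \<beta> + 1) /
     ((2 * real n + 2 * c + \<alpha> + \<beta> + 1) * (2 * real n + 2 * c + \<alpha> + \<beta> + 2))"

definition jac_mu :: "real \<Rightarrow> real \<Rightarrow> real \<Rightarrow> nat \<Rightarrow> real" where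
  "jac_mu \<alpha> \<beta> c n =
     (real n + c) * (real n + c + \<alpha>) /
     ((2 * real n + 2 * c + \<alpha> + \<beta>) * (2 * real n + 2 * c + \<alpha> + \<beta> + 1))"

text \<open>In both families the recursive equation is the three-term recurrence at $n = k + 1$.
  They differ only in the polynomial of degree one.\<close>

fun assoc_jacobi_V :: "real \<Rightarrow> real \<Rightarrow> real \<Rightarrow> nat \<Rightarrow> real poly" where
  "assoc_jacobi_V \<alpha> \<beta> c 0 = 1"
| "assoc_jacobi_V \<alpha> \<beta> c (Suc 0) = [:- jac_lambda \<alpha> \<beta> c 0 - jac_mu \<alpha> \<beta> c 0, 1:]"
| "assoc_jacobi_V \<alpha> \<beta> c (Suc (Suc k)) =
     [:- jac_lambda \<alpha> \<beta> c (Suc k) - jac_mu \<alpha> \<beta> c (Suc k), 1:] * assoc_jacobi_V \<alpha> \<beta> c (Suc k)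
     - smult (jac_lambda \<alpha> \<beta> c k * jac_mu \<alpha> \<beta> c (Suc k)) (assoc_jacobi_V \<alpha> \<beta> c k)"

fun assoc_jacobi_calV :: "real \<Rightarrow> real \<Rightarrow> real \<Rightarrow> nat \<Rightarrow> real poly" where
  "assoc_jacobi_calV \<alpha> \<beta> c 0 = 1"
| "assoc_jacobi_calV \<alpha> \<beta> c (Suc 0) = [:- jac_lambda \<alpha> \<beta> c 0, 1:]"
| "assoc_jacobi_calV \<alpha> \<beta> c (Suc (Suc k)) =
     [:- jac_lambda \<alpha> \<beta> c (Suc k) - jac_mu \<alpha> \<beta> c (Suc k), 1:] * assoc_jacobi_calV \<alpha> \<beta> c (Suc k)
     - smult (jac_lambda \<alpha> \<beta> c k * jac_mu \<alpha> \<beta> c (Suc k)) (assoc_jacobi_calV \<alpha> \<beta> c k)"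

definition param_set :: "(real \<times> real \<times> real) set" where
  "param_set = {(-1/2, -2/3, 13/12), (1/2, -2/3, 7/12), (-1/2, 2/3, 5/12), (1/2, 2/3, -1/12)}"

end

theory Submission
  imports Defs
begin

text \<open>Every parameter triple satisfies 2c + \<alpha> + \<beta> = 1, and the four numbers c, c + \<alpha>, c + \<beta>, c + \<alpha> + \<beta>
  are -1/12, 5/12, 7/12, 13/12 in some order. Hence the recurrence coefficients of all the associated
  Jacobi families coincide with those of the Atkin polynomials, shifted by one index. Each right-hand side
  is a combination of solutions of one common three-term recurrence, so only the first two
  terms have to be compared.\<close>

text \<open>\<open>c\<close> and \<open>n\<close> enter only through \<open>n + c\<close>. The shift
  is needed because \<open>c + 1\<close> leaves \<open>param_set\<close>.\<close>

lemma jac_lambda_add_one: "jac_lambda \<alpha> \<beta> (c + 1) n = jac_lambda \<alpha> \<beta> c (Suc n)"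
  by (simp add: jac_lambda_def algebra_simps)

lemma jac_mu_add_one: "jac_mu \<alpha> \<beta> (c + 1) n = jac_mu \<alpha> \<beta> c (Suc n)"
  by (simp add: jac_mu_def algebra_simps)

lemma jac_lambda_plus_mu:
  assumes "(\<alpha>, \<beta>, c) \<in> param_set"
  shows "jac_lambda \<alpha> \<beta> c n + jac_mu \<alpha> \<beta> c n = atkin_lin (Suc n)"
proof -
  define x where "x = real n"
  have nz: "2 * x + 1 \<noteq> 0" "2 * x + 2 \<noteq> 0" "2 * x + 3 \<noteq> 0"
    by (simp_all add: x_def add_eq_0_iff)
  define p where "p = (x + c + \<beta> + 1) * (x + c + \<alpha> + \<beta> + 1)"
  define q where "q = (x + c) * (x + c + \<alpha>)"
  have s: "2 * x + 2 * c + \<alpha> + \<beta> = 2 * x + 1"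
    using assms by (auto simp: param_set_def)
  \<comment> \<open>Put \<open>y = x + 1\<close>, \<open>a = 1 - c\<close>,
    \<open>b = 1 - c - \<alpha>\<close>. Since \<open>2 * c + \<alpha> + \<beta> = 1\<close>,
    \<open>p = (y + a) * (y + b)\<close> and \<open>q = (y - a) * (y - b)\<close>, so the left side
    is odd in \<open>y\<close> and divisible by \<open>2 * y\<close>. The constant arises because
    \<open>a * b - (a + b) / 2 = -29/144\<close> for all four triples.\<close>
  have num: "p * (2 * x + 1) + q * (2 * x + 3) = (2 * x + 2) * (2 * ((x + 1)^2 - 29/144))"
    unfolding p_def q_def
    by (insert assms [unfolded param_set_def],
        elim insertE emptyE Pair_inject; hypsubst; simp add: power2_eq_square field_simps)
  have "jac_lambda \<alpha> \<beta> c n + jac_mu \<alpha> \<beta> c n =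
      p / ((2 * x + 2) * (2 * x + 3)) + q / ((2 * x + 1) * (2 * x + 2))"
    unfolding jac_lambda_def jac_mu_def x_def [symmetric] s p_def q_def by (simp add: add.assoc)
  also have "\<dots> = (p * (2 * x + 1) + q * (2 * x + 3)) / ((2 * x + 1) * (2 * x + 2) * (2 * x + 3))"
    using nz by (simp add: divide_simps)
  also have "\<dots> = 2 * ((x + 1)^2 - 29/144) / ((2 * x + 1) * (2 * x + 3))"
    unfolding num using nz by simp
  also have "(2 * x + 1) * (2 * x + 3) = 4 * (x + 1)^2 - 1"
    by (simp add: power2_eq_square algebra_simps)
  finally show ?thesis
    by (simp add: atkin_lin_def x_def add.commute)
qed

lemma jac_lambda_times_mu:
  assumes "(\<alpha>, \<beta>, c) \<in> param_set"
  shows "jac_lambda \<alpha> \<beta> c n * jac_mu \<alpha> \<beta> c (Suc n) = atkin_const (Suc (Suc n))"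
proof -
  define x where "x = real n"
  have x: "real (Suc n) = x + 1" "real (Suc (Suc n)) = x + 2"
    by (simp_all add: x_def)
  have s: "2 * x + 2 * c + \<alpha> + \<beta> = 2 * x + 1" "2 * (x + 1) + 2 * c + \<alpha> + \<beta> = 2 * x + 3"
    using assms by (auto simp: param_set_def)
  \<comment> \<open>The set {-1/12, 5/12, 7/12, 13/12} is invariant under
    \<open>t \<mapsto> 1 - t\<close>, and \<open>x + 2 - t = x + 1 + (1 - t)\<close>.\<close>
  have num: "((x + c + \<beta> + 1) * (x + c + \<alpha> + \<beta> + 1)) * ((x + 1 + c) * (x + 1 + c + \<alpha>))
      = (x + 2 - 13/12) * (x + 2 - 7/12) * (x + 2 - 5/12) * (x + 2 + 1/12)"
    by (insert assms [unfolded param_set_def],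
        elim insertE emptyE Pair_inject; hypsubst; simp add: field_simps)
  have den: "((2 * x + 1 + 1) * (2 * x + 1 + 2)) * ((2 * x + 3) * (2 * x + 3 + 1))
      = 2 * (x + 2) * (2 * (x + 2) - 1)^2 * (2 * (x + 2) - 2)"
    by (simp add: power2_eq_square algebra_simps)
  show ?thesis
    unfolding jac_lambda_def jac_mu_def atkin_const_def x x_def [symmetric] s times_divide_times_eq num den ..
qed

text \<open>A three-term recurrence determines its solution from two initial terms. These are taken
  at indices 1 and 2, because the Atkin recurrence first produces index 3.\<close>

lemma scaled_atkin_Suc_eqI:
  assumes "P 0 = scaled_atkin 1" "P (Suc 0) = scaled_atkin 2"
    and "\<And>k. P (Suc (Suc k)) = [:- atkin_lin (Suc (Suc k)), 1:] * P (Suc k)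
                 - smult (atkin_const (Suc (Suc k))) (P k)"
  shows "scaled_atkin (Suc n) = P n"
proof (induction n rule: induct_nat_012)
  case 0
  then show ?case using assms(1) by simp
next
  case 1
  then show ?case using assms(2) by (simp add: numeral_2_eq_2)
next
  case (ge2 n)
  then show ?case by (simp add: assms(3))
qed

lemma assoc_jacobi_V_1:
  assumes "(\<alpha>, \<beta>, c) \<in> param_set"
  shows "assoc_jacobi_V \<alpha> \<beta> c (Suc 0) = [:- 115/216, 1:]"
  using jac_lambda_plus_mu [OF assms, of 0] by (simp add: atkin_lin_def)

lemma assoc_jacobi_V_rec:
  assumes "(\<alpha>, \<beta>, c) \<in> param_set"
  shows "assoc_jacobi_V \<alpha> \<beta> c (Suc (Suc k)) =
           [:- atkin_lin (Suc (Suc k)), 1:] * assoc_jacobi_V \<alpha> \<beta> c (Suc k)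
           - smult (atkin_const (Suc (Suc k))) (assoc_jacobi_V \<alpha> \<beta> c k)"
  using assms by (simp add: jac_lambda_plus_mu [symmetric] jac_lambda_times_mu [symmetric])

lemma assoc_jacobi_calV_rec:
  assumes "(\<alpha>, \<beta>, c) \<in> param_set"
  shows "assoc_jacobi_calV \<alpha> \<beta> c (Suc (Suc k)) =
           [:- atkin_lin (Suc (Suc k)), 1:] * assoc_jacobi_calV \<alpha> \<beta> c (Suc k)
           - smult (atkin_const (Suc (Suc k))) (assoc_jacobi_calV \<alpha> \<beta> c k)"
  using assms by (simp add: jac_lambda_plus_mu [symmetric] jac_lambda_times_mu [symmetric])

text \<open>Delaying the family for \<open>c + 1\<close> by one index undoes the shift of its
  coefficients. The value \<open>W 0 = 0\<close> extends the recurrence down to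
  \<open>k = 0\<close>, where it yields the degree-one polynomial.\<close>

lemma assoc_jacobi_V_add_one_rec:
  assumes "(\<alpha>, \<beta>, c) \<in> param_set"
  defines "W \<equiv> \<lambda>n. if n = 0 then 0 else assoc_jacobi_V \<alpha> \<beta> (c + 1) (n - 1)"
  shows "W (Suc (Suc k)) =
           [:- atkin_lin (Suc (Suc k)), 1:] * W (Suc k) - smult (atkin_const (Suc (Suc k))) (W k)"
  using assms(1) unfolding W_def
  by (cases k) (simp_all add: jac_lambda_add_one jac_mu_add_one
      jac_lambda_plus_mu [symmetric] jac_lambda_times_mu [symmetric])

text \<open>Solutions of a linear recurrence stay solutions when multiplied by a polynomial free of
  the index and added.\<close>

lemma three_term_combination:
  fixes a p u v u' v' :: "'a::comm_ring_1 poly"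
  shows "p * (a * u - smult d u') + smult e (a * v - smult d v')
       = a * (p * u + smult e v) - smult d (p * u' + smult e v')"
  by (simp add: algebra_simps smult_diff_right smult_add_right)

theorem theorem3p1:
  fixes n :: nat
  shows "(\<forall>(\<alpha>, \<beta>, c) \<in> param_set.
            scaled_atkin (n + 1) =
              [:- 5/12, 1:] * assoc_jacobi_V \<alpha> \<beta> c n
              - smult (455/3456) (if n = 0 then 0 else assoc_jacobi_V \<alpha> \<beta> (c + 1) (n - 1)))
       \<and> scaled_atkin (n + 1) =
            [:- 8, 1:] * assoc_jacobi_V (-1/2) (2/3) (5/12) n
            + smult (91/12) (assoc_jacobi_calV (-1/2) (2/3) (5/12) n)
       \<and> scaled_atkin (n + 1) =
            [:0, 1:] * assoc_jacobi_V (1/2) (-2/3) (7/12) n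
            - smult (5/12) (assoc_jacobi_calV (1/2) (-2/3) (7/12) n)"
proof (intro conjI)
  show "\<forall>(\<alpha>, \<beta>, c) \<in> param_set. scaled_atkin (n + 1) =
          [:- 5/12, 1:] * assoc_jacobi_V \<alpha> \<beta> c n
          - smult (455/3456) (if n = 0 then 0 else assoc_jacobi_V \<alpha> \<beta> (c + 1) (n - 1))"
  proof (clarify)
    fix \<alpha> \<beta> c :: real
    assume S: "(\<alpha>, \<beta>, c) \<in> param_set"
    define W where "W n = (if n = 0 then 0 else assoc_jacobi_V \<alpha> \<beta> (c + 1) (n - 1))" for n :: nat
    have "scaled_atkin (Suc n) = [:- 5/12, 1:] * assoc_jacobi_V \<alpha> \<beta> c n + smult (- 455/3456) (W n)"
    proof (rule scaled_atkin_Suc_eqI)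
      \<comment> \<open>As \<open>W 1 = 1\<close>, the constant 455/3456 is forced: it is
        (5/12)(115/216) - 935/10368.\<close>
      show "[:- 5/12, 1:] * assoc_jacobi_V \<alpha> \<beta> c (Suc 0) + smult (- 455/3456) (W (Suc 0)) = scaled_atkin 2"
        unfolding assoc_jacobi_V_1 [OF S] by (simp add: W_def numeral_2_eq_2 one_pCons)
      have rec: "W (Suc (Suc k)) = [:- atkin_lin (Suc (Suc k)), 1:] * W (Suc k)
          - smult (atkin_const (Suc (Suc k))) (W k)" for k
        unfolding W_def by (rule assoc_jacobi_V_add_one_rec [OF S])
      show "[:- 5/12, 1:] * assoc_jacobi_V \<alpha> \<beta> c (Suc (Suc k)) + smult (- 455/3456) (W (Suc (Suc k)))
          = [:- atkin_lin (Suc (Suc k)), 1:] *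
              ([:- 5/12, 1:] * assoc_jacobi_V \<alpha> \<beta> c (Suc k) + smult (- 455/3456) (W (Suc k)))
            - smult (atkin_const (Suc (Suc k)))
                ([:- 5/12, 1:] * assoc_jacobi_V \<alpha> \<beta> c k + smult (- 455/3456) (W k))" for k
        unfolding assoc_jacobi_V_rec [OF S] rec by (rule three_term_combination)
    qed (simp add: W_def)
    then show "scaled_atkin (n + 1) = [:- 5/12, 1:] * assoc_jacobi_V \<alpha> \<beta> c n
        - smult (455/3456) (if n = 0 then 0 else assoc_jacobi_V \<alpha> \<beta> (c + 1) (n - 1))"
      by (simp add: W_def)
  qed
next
  have S: "(-1/2, 2/3, 5/12) \<in> param_set"
    by (simp add: param_set_def)
  \<comment> \<open>The difference of the two Jacobi families starts with 0 and
    \<open>jac_mu\<close> at 0, here -5/288. Hence 91/12 = (-455/3456) / (-5/288), and 8 = 5/12 +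
    91/12 makes the first term \<open>x - 5/12\<close>.\<close>
  have "scaled_atkin (Suc n) = [:- 8, 1:] * assoc_jacobi_V (-1/2) (2/3) (5/12) n + smult (91/12) (assoc_jacobi_calV (-1/2) (2/3) (5/12) n)"
  proof (rule scaled_atkin_Suc_eqI)
    show "[:- 8, 1:] * assoc_jacobi_V (-1/2) (2/3) (5/12) (Suc 0) + smult (91/12) (assoc_jacobi_calV (-1/2) (2/3) (5/12) (Suc 0)) = scaled_atkin 2"
      unfolding assoc_jacobi_V_1 [OF S] by (simp add: jac_lambda_def numeral_2_eq_2)
    show "[:- 8, 1:] * assoc_jacobi_V (-1/2) (2/3) (5/12) (Suc (Suc k)) + smult (91/12) (assoc_jacobi_calV (-1/2) (2/3) (5/12) (Suc (Suc k)))
        = [:- atkin_lin (Suc (Suc k)), 1:] *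
            ([:- 8, 1:] * assoc_jacobi_V (-1/2) (2/3) (5/12) (Suc k) + smult (91/12) (assoc_jacobi_calV (-1/2) (2/3) (5/12) (Suc k)))
          - smult (atkin_const (Suc (Suc k)))
              ([:- 8, 1:] * assoc_jacobi_V (-1/2) (2/3) (5/12) k + smult (91/12) (assoc_jacobi_calV (-1/2) (2/3) (5/12) k))" for k
      unfolding assoc_jacobi_V_rec [OF S] assoc_jacobi_calV_rec [OF S] by (rule three_term_combination)
  qed (simp add: one_pCons)
  then show "scaled_atkin (n + 1) = [:- 8, 1:] * assoc_jacobi_V (-1/2) (2/3) (5/12) n + smult (91/12) (assoc_jacobi_calV (-1/2) (2/3) (5/12) n)"
    by simp
next
  have S: "(1/2, -2/3, 7/12) \<in> param_set"
    by (simp add: param_set_def)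
  \<comment> \<open>Here \<open>jac_mu\<close> at 0 is 91/288, so the same computation gives the
    factor -5/12, and the shift 5/12 - 5/12 vanishes.\<close>
  have "scaled_atkin (Suc n) = [:0, 1:] * assoc_jacobi_V (1/2) (-2/3) (7/12) n + smult (- 5/12) (assoc_jacobi_calV (1/2) (-2/3) (7/12) n)"
  proof (rule scaled_atkin_Suc_eqI)
    show "[:0, 1:] * assoc_jacobi_V (1/2) (-2/3) (7/12) (Suc 0) + smult (- 5/12) (assoc_jacobi_calV (1/2) (-2/3) (7/12) (Suc 0)) = scaled_atkin 2"
      unfolding assoc_jacobi_V_1 [OF S] by (simp add: jac_lambda_def numeral_2_eq_2)
    show "[:0, 1:] * assoc_jacobi_V (1/2) (-2/3) (7/12) (Suc (Suc k)) + smult (- 5/12) (assoc_jacobi_calV (1/2) (-2/3) (7/12) (Suc (Suc k)))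
        = [:- atkin_lin (Suc (Suc k)), 1:] *
            ([:0, 1:] * assoc_jacobi_V (1/2) (-2/3) (7/12) (Suc k) + smult (- 5/12) (assoc_jacobi_calV (1/2) (-2/3) (7/12) (Suc k)))
          - smult (atkin_const (Suc (Suc k)))
              ([:0, 1:] * assoc_jacobi_V (1/2) (-2/3) (7/12) k + smult (- 5/12) (assoc_jacobi_calV (1/2) (-2/3) (7/12) k))" for k
      unfolding assoc_jacobi_V_rec [OF S] assoc_jacobi_calV_rec [OF S] by (rule three_term_combination)
  qed (simp add: one_pCons)
  then show "scaled_atkin (n + 1) = [:0, 1:] * assoc_jacobi_V (1/2) (-2/3) (7/12) n - smult (5/12) (assoc_jacobi_calV (1/2) (-2/3) (7/12) n)"
    by simp
qed

end
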